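(* Let $G=(V,E)$ be a finite connected simple graph which contains a cycle (of length at least $3$). Then $\Lambda_1(G)=\infty$, i.e. for every $M>0$ there is an edge-length function $l\colon E\to\mathbb{R}_{>0}$ with $2\sum_{uv\in E} l(uv)=1$ and $\lambda_1(G,l)>M$.
   Context: For a finite connected simple graph $G=(V,E)$ and an edge-length function $l\colon E\to\mathbb{R}_{>0}$, define the vertex weight $m_0(u)=\sum_{v\sim u} l(uv)$ and edge weight $m_1(uv)=1/l(uv)$. The Fujiwara Laplacian $\Delta_l$ acts on functions $\varphi\colon V\to\mathbb{R}$ by $(\Delta_l\varphi)(u)=\sum_{v\sim u}\frac{m_1(uv)}{m_0(u)}(\varphi(u)-\varphi(v))$; it is self-adjoint and nonnegative with respect to the inner product $\langle\varphi_1,\varphi_2\rangle=\sum_{u} m_0(u)\varphi_1(u)\varphi_2(u)$, its kernel consists of the constants, and $\lambda_1(G,l)$ denotes its smallest positive eigenvalue, equivalently $\lambda_1(G,l)=\min\frac{\sum_{uv\in E} m_1(uv)(\varphi(u)-\varphi(v))^2}{\sum_{u\in V} m_0(u)\varphi(u)^2}$ over nonzero $\varphi$ with $\sum_u m_0(u)\varphi(u)=0$. Define $\Lambda_1(G)=\sup_l \lambda_1(G,l)$ over all $l$ satisfying the normalization $\sum_{u\in V} m_0(u)=2\sum_{uv\in E}l(uv)=1$; equivalently $\Lambda_1(G)=\sup_l \lambda_1(G,l)\,\bigl(\sum_{u}m_0(u)\bigr)^2$ over all (unnormalized) $l$. *)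

theory Defs
  imports
    "HOL-Library.Extended_Real"
    "Graph_Theory.Graph_Theory"
begin

text \<open>
  A finite simple graph is a \<^const>\<open>pair_graph\<close>: finite, loop-free, symmetric, no parallel arcs. The
  undirected edge \<open>uv\<close>, i.e. the pair of arcs \<open>(u,v)\<close> and \<open>(v,u)\<close>, is the doubleton \<open>{u,v}\<close>; edge
  lengths are functions on such doubletons, whose values off the edge set are irrelevant.
\<close>

definition edges :: "'a pair_pre_digraph \<Rightarrow> 'a set set" where
  "edges G = {{u, v} | u v. (u, v) \<in> parcs G}"

definition nbrs :: "'a pair_pre_digraph \<Rightarrow> 'a \<Rightarrow> 'a set" where
  "nbrs G u = {v \<in> pverts G. (u, v) \<in> parcs G}"

definition edge_length :: "'a pair_pre_digraph \<Rightarrow> ('a set \<Rightarrow> real) \<Rightarrow> bool" where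
  "edge_length G l \<longleftrightarrow> (\<forall>e \<in> edges G. 0 < l e)"

definition m0 :: "'a pair_pre_digraph \<Rightarrow> ('a set \<Rightarrow> real) \<Rightarrow> 'a \<Rightarrow> real" where
  "m0 G l u = (\<Sum>v \<in> nbrs G u. l {u, v})"

definition m1 :: "('a set \<Rightarrow> real) \<Rightarrow> 'a set \<Rightarrow> real" where
  "m1 l e = 1 / l e"

definition fujiwara_laplacian ::
    "'a pair_pre_digraph \<Rightarrow> ('a set \<Rightarrow> real) \<Rightarrow> ('a \<Rightarrow> real) \<Rightarrow> 'a \<Rightarrow> real" where
  "fujiwara_laplacian G l \<phi> u = (\<Sum>v \<in> nbrs G u. m1 l {u, v} / m0 G l u * (\<phi> u - \<phi> v))"

text \<open>Functions on the vertex set are compared on \<^term>\<open>pverts G\<close> only.\<close>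

definition fujiwara_eigenvalue ::
    "'a pair_pre_digraph \<Rightarrow> ('a set \<Rightarrow> real) \<Rightarrow> real \<Rightarrow> bool" where
  "fujiwara_eigenvalue G l \<mu> \<longleftrightarrow>
     (\<exists>\<phi>. (\<exists>u \<in> pverts G. \<phi> u \<noteq> 0) \<and>
          (\<forall>u \<in> pverts G. fujiwara_laplacian G l \<phi> u = \<mu> * \<phi> u))"

definition lambda1 :: "'a pair_pre_digraph \<Rightarrow> ('a set \<Rightarrow> real) \<Rightarrow> real" where
  "lambda1 G l = (LEAST \<mu>. 0 < \<mu> \<and> fujiwara_eigenvalue G l \<mu>)"

definition Lambda1 :: "'a pair_pre_digraph \<Rightarrow> ereal" where
  "Lambda1 G = (SUP l \<in> {l. edge_length G l \<and> (\<Sum>u \<in> pverts G. m0 G l u) = 1}. ereal (lambda1 G l))"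

lemma (in pair_graph) sum_m0: "(\<Sum>u \<in> pverts G. m0 G l u) = 2 * (\<Sum>e \<in> edges G. l e)"
proof -
  have nb: "nbrs G u = {v. (u, v) \<in> parcs G}" for u
    unfolding nbrs_def using in_arcsD2 by auto
  have S: "Sigma (pverts G) (nbrs G) = parcs G"
    unfolding nb using in_arcsD1 by auto
  have fn: "finite (nbrs G u)" for u
    unfolding nbrs_def using pair_finite_verts by simp
  have "(\<Sum>u \<in> pverts G. m0 G l u) = (\<Sum>(u, v) \<in> parcs G. l {u, v})"
    unfolding m0_def using S fn by (subst sum.Sigma) (auto simp: pair_finite_verts)
  also have "\<dots> = (\<Sum>a \<in> parcs G. l {fst a, snd a})"
    by (simp add: case_prod_beta)
  also have "\<dots> = (\<Sum>e \<in> edges G. \<Sum>a \<in> {a \<in> parcs G. {fst a, snd a} = e}. l {fst a, snd a})"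
  proof -
    have e: "edges G = (\<lambda>a. {fst a, snd a}) ` parcs G"
      unfolding edges_def by force
    show ?thesis
      unfolding e by (rule sum.image_gen[OF pair_finite_arcs])
  qed
  also have "\<dots> = (\<Sum>e \<in> edges G. 2 * l e)"
  proof (rule sum.cong[OF refl])
    fix e assume "e \<in> edges G"
    then obtain u v where uv: "e = {u, v}" "(u, v) \<in> parcs G" unfolding edges_def by auto
    have ne: "u \<noteq> v" using uv no_loops' by auto
    have "{a \<in> parcs G. {fst a, snd a} = e} = {(u, v), (v, u)}"
      using uv arcs_symmetric by (auto simp: doubleton_eq_iff)
    then show "(\<Sum>a \<in> {a \<in> parcs G. {fst a, snd a} = e}. l {fst a, snd a}) = 2 * l e"
      using ne uv by (simp add: insert_commute)
  qed
  finally show ?thesis by (simp add: sum_distrib_left)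
qed

end

theory Submission
  imports Defs "HOL-Analysis.Function_Topology"
begin

text \<open>
  Choose an edge \<open>e\<close> of a cycle, give every other edge the length \<open>\<epsilon>\<close> and let \<open>e\<close> carry the remaining
  length. Since \<open>G - e\<close> is still connected, any two vertices are joined by boundedly many edges of
  conductance \<open>1 / \<epsilon>\<close>, so a function of energy \<open>E\<close> oscillates by at most a constant times
  \<open>sqrt (\<epsilon> E)\<close>. As the total mass is \<open>1\<close>, the squared norm of a function of mean zero is at most the
  square of its oscillation; hence \<open>\<lambda>\<^sub>1\<close> is at least of order \<open>1 / \<epsilon>\<close>.
\<close>

section \<open>Spectral gap of a finite weighted network\<close>

text \<open>First-variation principle: a quadratic in t that vanishes at 0 and is nonnegative
  everywhere has derivative zero there.\<close>

lemma linear_coefficient_zero: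
  fixes p q :: real
  assumes "\<And>t. 0 \<le> 2 * t * p + t\<^sup>2 * q"
  shows "p = 0"
proof (rule ccontr)
  assume "p \<noteq> 0"
  \<comment> \<open>Any positive r with q < 2r works: at t = -p/r the negative linear term outweighs
    the quadratic one.\<close>
  define r where "r = \<bar>q\<bar> + 1"
  have "0 < r" "q < 2 * r" by (auto simp: r_def)
  have "0 \<le> 2 * (- p / r) * p + (- p / r)\<^sup>2 * q" by (rule assms)
  also have "\<dots> = p\<^sup>2 * (q - 2 * r) / r\<^sup>2"
    using \<open>0 < r\<close> by (simp add: field_simps power2_eq_square)
  also have "\<dots> < 0"
    using \<open>p \<noteq> 0\<close> \<open>0 < r\<close> \<open>q < 2 * r\<close> by (intro divide_neg_pos mult_pos_neg) auto
  finally show False by simp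
qed

locale weighted_network =
  fixes V :: "'a set" and w :: "'a \<Rightarrow> 'a \<Rightarrow> real" and m :: "'a \<Rightarrow> real"
  assumes finite_V: "finite V"
    and w_sym: "w u v = w v u"
    and m_pos: "u \<in> V \<Longrightarrow> 0 < m u"
    and total_mass: "(\<Sum>u\<in>V. m u) = 1"
begin

definition mean :: "('a \<Rightarrow> real) \<Rightarrow> real" where
  "mean \<phi> = (\<Sum>u\<in>V. m u * \<phi> u)"

definition sqnorm :: "('a \<Rightarrow> real) \<Rightarrow> real" where
  "sqnorm \<phi> = (\<Sum>u\<in>V. m u * (\<phi> u)\<^sup>2)"

text \<open>Halving compensates for each undirected edge occurring as two ordered pairs.\<close>

definition form :: "('a \<Rightarrow> real) \<Rightarrow> ('a \<Rightarrow> real) \<Rightarrow> real" where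
  "form \<phi> \<psi> = (\<Sum>u\<in>V. \<Sum>v\<in>V. w u v * ((\<phi> u - \<phi> v) * (\<psi> u - \<psi> v))) / 2"

definition laplacian :: "('a \<Rightarrow> real) \<Rightarrow> 'a \<Rightarrow> real" where
  "laplacian \<phi> u = (\<Sum>v\<in>V. w u v * (\<phi> u - \<phi> v)) / m u"

text \<open>Green's formula. The sums belonging to \<open>\<psi> u\<close> and
  \<open>\<psi> v\<close> are negatives of each other, by exchanging the two variables and the
  symmetry of \<open>w\<close>.\<close>

lemma form_eq_inner_laplacian: "form \<phi> \<psi> = (\<Sum>u\<in>V. m u * laplacian \<phi> u * \<psi> u)"
proof -
  let ?A = "\<Sum>u\<in>V. \<Sum>v\<in>V. w u v * (\<phi> u - \<phi> v) * \<psi> u"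
  have "(\<Sum>u\<in>V. \<Sum>v\<in>V. w u v * (\<phi> u - \<phi> v) * \<psi> v) =
      (\<Sum>v\<in>V. \<Sum>u\<in>V. w u v * (\<phi> u - \<phi> v) * \<psi> v)"
    by (rule sum.swap)
  also have "\<dots> = (\<Sum>v\<in>V. \<Sum>u\<in>V. - (w v u * (\<phi> v - \<phi> u) * \<psi> v))"
    by (intro sum.cong refl, subst w_sym) (simp add: algebra_simps)
  also have "\<dots> = - ?A"
    by (simp add: sum_negf)
  finally have "2 * form \<phi> \<psi> = 2 * ?A"
    unfolding form_def by (simp add: right_diff_distrib sum_subtractf flip: mult.assoc)
  moreover have "?A = (\<Sum>u\<in>V. m u * laplacian \<phi> u * \<psi> u)"
    using m_pos by (intro sum.cong refl) (simp add: laplacian_def sum_distrib_right less_imp_neq[symmetric])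
  ultimately show ?thesis by simp
qed

lemma form_add_scaled:
  "form (\<lambda>u. \<phi> u + t * \<psi> u) (\<lambda>u. \<phi> u + t * \<psi> u) =
    form \<phi> \<phi> + 2 * t * form \<phi> \<psi> + t\<^sup>2 * form \<psi> \<psi>"
proof -
  have "(\<Sum>u\<in>V. \<Sum>v\<in>V. w u v * ((\<phi> u + t * \<psi> u - (\<phi> v + t * \<psi> v)) * (\<phi> u + t * \<psi> u - (\<phi> v + t * \<psi> v)))) =
    (\<Sum>u\<in>V. \<Sum>v\<in>V. w u v * ((\<phi> u - \<phi> v) * (\<phi> u - \<phi> v)) +
      2 * t * (w u v * ((\<phi> u - \<phi> v) * (\<psi> u - \<psi> v))) +
      t\<^sup>2 * (w u v * ((\<psi> u - \<psi> v) * (\<psi> u - \<psi> v))))"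
    by (intro sum.cong refl) (simp add: power2_eq_square algebra_simps)
  then show ?thesis
    unfolding form_def by (simp add: sum.distrib flip: sum_distrib_left)
qed

lemma form_scaled: "form (\<lambda>u. c * \<phi> u) (\<lambda>u. c * \<phi> u) = c\<^sup>2 * form \<phi> \<phi>"
  using form_add_scaled[of "\<lambda>_. 0" c \<phi>] by (simp add: form_def)

lemma form_shift: "form (\<lambda>u. \<phi> u - c) (\<lambda>u. \<phi> u - c) = form \<phi> \<phi>"
  by (simp add: form_def)

lemma sqnorm_scaled: "sqnorm (\<lambda>u. c * \<phi> u) = c\<^sup>2 * sqnorm \<phi>"
  by (simp add: sqnorm_def sum_distrib_left power_mult_distrib algebra_simps)

lemma mean_scaled: "mean (\<lambda>u. c * \<phi> u) = c * mean \<phi>"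
  by (simp add: mean_def sum_distrib_left algebra_simps)

lemma mean_shift: "mean (\<lambda>u. \<phi> u - c) = mean \<phi> - c"
  using total_mass by (simp add: mean_def right_diff_distrib sum_subtractf flip: sum_distrib_right)

lemma mean_add_scaled: "mean (\<lambda>u. \<phi> u + t * \<psi> u) = mean \<phi> + t * mean \<psi>"
  by (simp add: mean_def sum_distrib_left algebra_simps sum.distrib)

lemma sqnorm_add_scaled:
  "sqnorm (\<lambda>u. \<phi> u + t * \<psi> u) =
    sqnorm \<phi> + 2 * t * (\<Sum>u\<in>V. m u * \<phi> u * \<psi> u) + t\<^sup>2 * sqnorm \<psi>"
  by (simp add: sqnorm_def sum_distrib_left power2_eq_square algebra_simps flip: sum.distrib)

lemma sqnorm_shift_mean: "sqnorm (\<lambda>u. \<phi> u - mean \<phi>) = sqnorm \<phi> - (mean \<phi>)\<^sup>2"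
proof -
  have "sqnorm (\<lambda>u. \<phi> u - c) = sqnorm \<phi> - 2 * c * mean \<phi> + c\<^sup>2" for c
    using sqnorm_add_scaled[of \<phi> "- c" "\<lambda>_. 1"] total_mass
    by (simp add: mean_def sqnorm_def)
  from this[of "mean \<phi>"] show ?thesis by (simp add: power2_eq_square)
qed

lemma sqnorm_nonneg: "0 \<le> sqnorm \<phi>"
  unfolding sqnorm_def by (intro sum_nonneg mult_nonneg_nonneg) (auto simp: m_pos less_imp_le)

lemma sqnorm_pos:
  assumes "u \<in> V" "\<phi> u \<noteq> 0"
  shows "0 < sqnorm \<phi>"
  unfolding sqnorm_def
  by (rule sum_pos2[OF finite_V assms(1)]) (auto simp: assms m_pos less_imp_le)

section \<open>Minimisers of the Rayleigh quotient\<close>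

lemma exists_minimizer:
  assumes "a \<in> V" "b \<in> V" "a \<noteq> b"
  obtains \<phi> where "mean \<phi> = 0" "sqnorm \<phi> = 1"
    "\<And>\<psi>. mean \<psi> = 0 \<Longrightarrow> sqnorm \<psi> = 1 \<Longrightarrow> form \<phi> \<phi> \<le> form \<psi> \<psi>"
proof -
  \<comment> \<open>On the unit sphere each term \<open>m u * (\<phi> u)\<^sup>2\<close> is at most
    1, which gives the bounds. The type may be infinite, so coordinates off \<open>V\<close> are
    pinned to 0; Tychonoff then makes the box compact.\<close>
  define box where
    "box = PiE UNIV (\<lambda>u. if u \<in> V then {- sqrt (1 / m u) .. sqrt (1 / m u)} else {0::real})"
  define K where "K = box \<inter> {\<phi>. mean \<phi> = 0} \<inter> {\<phi>. sqnorm \<phi> = 1}"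
  have coord: "continuous_on UNIV (\<lambda>\<phi>. \<phi> u)" for u :: 'a
    by simp
  have "compactin (product_topology (\<lambda>i. euclidean) UNIV) box"
    unfolding box_def compactin_PiE by simp
  then have "compact box"
    by (simp add: euclidean_product_topology)
  moreover have "closed {\<phi>. mean \<phi> = 0}" "closed {\<phi>. sqnorm \<phi> = 1}"
    unfolding mean_def sqnorm_def
    by (intro closed_Collect_eq continuous_intros coord)+
  ultimately have "compact K"
    unfolding K_def by (intro compact_Int_closed)
  \<comment> \<open>Values off \<open>V\<close> affect none of the three quantities, so a minimum
    over \<open>K\<close> is a minimum over all admissible functions.\<close>
  have restrict: "\<exists>\<psi>'\<in>K. form \<psi>' \<psi>' = form \<psi> \<psi>" if "mean \<psi> = 0" "sqnorm \<psi> = 1" for \<psi>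
  proof
    let ?\<psi> = "\<lambda>u. if u \<in> V then \<psi> u else 0"
    have "\<bar>\<psi> u\<bar> \<le> sqrt (1 / m u)" if "u \<in> V" for u
    proof -
      have "m u * (\<psi> u)\<^sup>2 \<le> sqnorm \<psi>"
        unfolding sqnorm_def using that finite_V m_pos
        by (intro member_le_sum) (auto simp: less_imp_le)
      then show ?thesis
        using \<open>sqnorm \<psi> = 1\<close> m_pos[OF that]
        by (intro real_le_rsqrt) (simp add: field_simps)
    qed
    then have "?\<psi> \<in> box"
      unfolding box_def by (auto simp: abs_le_iff minus_le_iff)
    moreover have "mean ?\<psi> = mean \<psi>" "sqnorm ?\<psi> = sqnorm \<psi>"
      unfolding mean_def sqnorm_def by (auto intro!: sum.cong)
    ultimately show "?\<psi> \<in> K"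
      unfolding K_def using that by simp
    show "form ?\<psi> ?\<psi> = form \<psi> \<psi>"
      unfolding form_def by (auto intro!: sum.cong)
  qed
  \<comment> \<open>A difference of two point masses, weighted so that its mean cancels; normalised,
    it shows that \<open>K\<close> is nonempty.\<close>
  define \<chi> where "\<chi> u = (if u = a then 1 / m a else if u = b then - 1 / m b else 0)" for u
  have "mean \<chi> = (\<Sum>u\<in>{a, b}. m u * \<chi> u)"
    unfolding mean_def by (rule sum.mono_neutral_right) (auto simp: finite_V assms \<chi>_def)
  then have \<chi>0: "mean \<chi> = 0"
    using assms m_pos[OF assms(1)] m_pos[OF assms(2)] by (simp add: \<chi>_def)
  have \<chi>1: "0 < sqnorm \<chi>"
    using m_pos[OF assms(1)] by (intro sqnorm_pos[OF assms(1)]) (simp add: \<chi>_def)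
  have "K \<noteq> {}"
    using restrict[of "\<lambda>u. (1 / sqrt (sqnorm \<chi>)) * \<chi> u"] \<chi>0 \<chi>1
    unfolding mean_scaled sqnorm_scaled by (auto simp: power_divide)
  moreover have "continuous_on K (\<lambda>\<phi>. form \<phi> \<phi>)"
    unfolding form_def
    by (intro continuous_intros continuous_on_subset[OF coord subset_UNIV]) simp
  ultimately obtain \<phi> where \<phi>: "\<phi> \<in> K" "\<And>\<psi>. \<psi> \<in> K \<Longrightarrow> form \<phi> \<phi> \<le> form \<psi> \<psi>"
    using continuous_attains_inf[OF \<open>compact K\<close>] by blast
  show thesis
    by (rule that) (use \<phi> restrict in \<open>auto simp: K_def, metis\<close>)
qed

text \<open>Centre and normalise. Replacing the constraints by the variance makes the bound hold for
  every function, so that variations in arbitrary directions become available.\<close>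

lemma rayleigh_bound:
  assumes "\<And>\<psi>. mean \<psi> = 0 \<Longrightarrow> sqnorm \<psi> = 1 \<Longrightarrow> \<kappa> \<le> form \<psi> \<psi>"
  shows "\<kappa> * (sqnorm \<psi> - (mean \<psi>)\<^sup>2) \<le> form \<psi> \<psi>"
proof -
  define \<eta> where "\<eta> = (\<lambda>u. \<psi> u - mean \<psi>)"
  have \<eta>: "mean \<eta> = 0" "sqnorm \<eta> = sqnorm \<psi> - (mean \<psi>)\<^sup>2" "form \<eta> \<eta> = form \<psi> \<psi>"
    unfolding \<eta>_def mean_shift sqnorm_shift_mean form_shift by simp_all
  show ?thesis
  proof (cases "sqnorm \<eta> = 0")
    case True
    then have "\<eta> u = 0" if "u \<in> V" for u
      using sqnorm_pos[OF that, of \<eta>] by auto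
    then have "form \<eta> \<eta> = 0"
      unfolding form_def by simp
    with True \<eta> show ?thesis by simp
  next
    case False
    then have pos: "0 < sqnorm \<eta>"
      using sqnorm_nonneg[of \<eta>] by simp
    have "\<kappa> \<le> form (\<lambda>u. (1 / sqrt (sqnorm \<eta>)) * \<eta> u) (\<lambda>u. (1 / sqrt (sqnorm \<eta>)) * \<eta> u)"
      using pos \<eta>(1) by (intro assms) (simp_all only: mean_scaled sqnorm_scaled, simp_all add: power_divide)
    then have "\<kappa> \<le> form \<eta> \<eta> / sqnorm \<eta>"
      unfolding form_scaled using pos by (simp add: power_divide)
    then have "\<kappa> * sqnorm \<eta> \<le> form \<eta> \<eta>"
      using pos by (simp add: pos_le_divide_eq)
    then show ?thesis by (simp only: \<eta>)
  qed
qed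

text \<open>A minimiser \<open>\<phi>\<close> of the Rayleigh quotient is a zero of the positive semidefinite quadratic form
  \<open>form \<psi> \<psi> - \<kappa> (sqnorm \<psi> - (mean \<psi>)\<^sup>2)\<close> with
  \<open>\<kappa> = form \<phi> \<phi>\<close>, so it lies in its kernel; testing against indicator
  functions of vertices gives the eigenvalue equation.\<close>

lemma minimizer_eigenfunction:
  assumes "mean \<phi> = 0" "sqnorm \<phi> = 1"
    and min: "\<And>\<psi>. mean \<psi> = 0 \<Longrightarrow> sqnorm \<psi> = 1 \<Longrightarrow> form \<phi> \<phi> \<le> form \<psi> \<psi>"
    and "u \<in> V"
  shows "laplacian \<phi> u = form \<phi> \<phi> * \<phi> u"
proof -
  define \<psi> where "\<psi> v = (if v = u then 1 else 0::real)" for v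
  define \<kappa> where "\<kappa> = form \<phi> \<phi>"
  have "form \<phi> \<psi> - \<kappa> * (\<Sum>v\<in>V. m v * \<phi> v * \<psi> v) = 0"
  proof (rule linear_coefficient_zero)
    fix t
    show "0 \<le> 2 * t * (form \<phi> \<psi> - \<kappa> * (\<Sum>v\<in>V. m v * \<phi> v * \<psi> v)) +
        t\<^sup>2 * (form \<psi> \<psi> - \<kappa> * (sqnorm \<psi> - (mean \<psi>)\<^sup>2))"
      \<comment> \<open>The constant term cancels because \<open>\<phi>\<close> has norm 1, mean 0
        and energy \<open>\<kappa>\<close>.\<close>
      using rayleigh_bound[of \<kappa> "\<lambda>v. \<phi> v + t * \<psi> v", OF min[folded \<kappa>_def]]
      unfolding form_add_scaled mean_add_scaled sqnorm_add_scaled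
      by (simp add: assms(1,2) \<kappa>_def[symmetric] algebra_simps power_mult_distrib)
  qed
  moreover have "(\<Sum>v\<in>V. m v * \<phi> v * \<psi> v) = m u * \<phi> u"
    "form \<phi> \<psi> = m u * laplacian \<phi> u"
    unfolding form_eq_inner_laplacian \<psi>_def
    using \<open>u \<in> V\<close> finite_V by (simp_all add: if_distrib cong: if_cong)
  ultimately show ?thesis
    using m_pos[OF \<open>u \<in> V\<close>] by (simp add: \<kappa>_def)
qed

definition eigenvalue :: "real \<Rightarrow> bool" where
  "eigenvalue \<mu> \<longleftrightarrow> (\<exists>\<phi>. (\<exists>u\<in>V. \<phi> u \<noteq> 0) \<and> (\<forall>u\<in>V. laplacian \<phi> u = \<mu> * \<phi> u))"

text \<open>\<open>LEAST\<close> on the reals is informative only if the minimum is attained. The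
  minimiser's energy attains it: it is an eigenvalue, it is positive by the gap, and it bounds every
  positive eigenvalue from below.\<close>

lemma least_positive_eigenvalue_ge:
  assumes "a \<in> V" "b \<in> V" "a \<noteq> b" and "0 < c"
    and gap: "\<And>\<psi>. mean \<psi> = 0 \<Longrightarrow> c * sqnorm \<psi> \<le> form \<psi> \<psi>"
  shows "c \<le> (LEAST \<mu>. 0 < \<mu> \<and> eigenvalue \<mu>)"
proof -
  obtain \<phi> where \<phi>: "mean \<phi> = 0" "sqnorm \<phi> = 1"
    and min: "\<And>\<psi>. mean \<psi> = 0 \<Longrightarrow> sqnorm \<psi> = 1 \<Longrightarrow> form \<phi> \<phi> \<le> form \<psi> \<psi>"
    using exists_minimizer[OF assms(1-3)] by metis
  have c: "c \<le> form \<phi> \<phi>"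
    using gap[OF \<phi>(1)] \<phi>(2) by simp
  have "\<exists>u\<in>V. \<phi> u \<noteq> 0"
  proof (rule ccontr)
    assume "\<not> ?thesis"
    then have "sqnorm \<phi> = 0" unfolding sqnorm_def by simp
    with \<phi>(2) show False by simp
  qed
  then have ev: "eigenvalue (form \<phi> \<phi>)"
    unfolding eigenvalue_def using minimizer_eigenfunction[OF \<phi> min] by blast
  have "form \<phi> \<phi> \<le> \<mu>" if \<mu>: "0 < \<mu>" "eigenvalue \<mu>" for \<mu>
  proof -
    obtain \<psi> u where u: "u \<in> V" "\<psi> u \<noteq> 0" and eq: "\<And>u. u \<in> V \<Longrightarrow> laplacian \<psi> u = \<mu> * \<psi> u"
      using \<mu>(2) unfolding eigenvalue_def by blast
    have inner: "form \<psi> \<eta> = \<mu> * (\<Sum>u\<in>V. m u * \<psi> u * \<eta> u)" for \<eta>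
      unfolding form_eq_inner_laplacian sum_distrib_left
      by (intro sum.cong) (auto simp: eq)
    \<comment> \<open>Testing the eigenvalue equation against constants forces mean zero, since
      \<open>\<mu>\<close> is nonzero.\<close>
    have "form \<psi> (\<lambda>_. 1) = 0"
      by (simp add: form_def)
    then have "mean \<psi> = 0"
      using inner[of "\<lambda>_. 1"] \<mu>(1) by (simp add: mean_def)
    then have "form \<phi> \<phi> * sqnorm \<psi> \<le> form \<psi> \<psi>"
      using rayleigh_bound[of "form \<phi> \<phi>" \<psi>, OF min] by simp
    also have "\<dots> = \<mu> * sqnorm \<psi>"
      using inner[of \<psi>] by (simp add: sqnorm_def power2_eq_square mult.assoc)
    finally show ?thesis
      using sqnorm_pos[of u \<psi>, OF u] by simp
  qed
  then have "(LEAST \<mu>. 0 < \<mu> \<and> eigenvalue \<mu>) = form \<phi> \<phi>"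
    using ev c \<open>0 < c\<close> by (intro Least_equality) auto
  with c show ?thesis by simp
qed

section \<open>Norm, oscillation and energy\<close>

text \<open>With mean zero and mass 1, \<open>\<phi> x\<close> is the weighted average of the
  differences \<open>\<phi> x - \<phi> y\<close>.\<close>

lemma sqnorm_le_oscillation:
  assumes "mean \<phi> = 0" and osc: "\<And>x y. x \<in> V \<Longrightarrow> y \<in> V \<Longrightarrow> \<bar>\<phi> x - \<phi> y\<bar> \<le> D"
  shows "sqnorm \<phi> \<le> D\<^sup>2"
proof -
  have "\<bar>\<phi> x\<bar> \<le> D" if "x \<in> V" for x
  proof -
    have "\<phi> x = (\<Sum>y\<in>V. m y * (\<phi> x - \<phi> y))"
      using assms(1) total_mass
      by (simp add: mean_def right_diff_distrib sum_subtractf flip: sum_distrib_right)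
    also have "\<bar>\<dots>\<bar> \<le> (\<Sum>y\<in>V. \<bar>m y * (\<phi> x - \<phi> y)\<bar>)"
      by (rule sum_abs)
    also have "\<dots> \<le> (\<Sum>y\<in>V. m y * D)"
      using osc[OF that] m_pos
      by (intro sum_mono) (auto simp: abs_mult less_imp_le abs_of_pos intro!: mult_left_mono)
    also have "\<dots> = D"
      using total_mass by (simp flip: sum_distrib_right)
    finally show ?thesis .
  qed
  then have "sqnorm \<phi> \<le> (\<Sum>x\<in>V. m x * D\<^sup>2)"
    unfolding sqnorm_def
    by (intro sum_mono mult_left_mono) (auto simp: m_pos less_imp_le abs_le_square_iff[symmetric] intro: order_trans[OF _ abs_ge_self])
  also have "\<dots> = D\<^sup>2"
    using total_mass by (simp flip: sum_distrib_right)
  finally show ?thesis .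
qed

lemma form_ge_term:
  assumes "\<And>u v. 0 \<le> w u v" and "x \<in> V" "y \<in> V"
  shows "w x y * (\<phi> x - \<phi> y)\<^sup>2 \<le> 2 * form \<phi> \<phi>"
proof -
  have "w x y * (\<phi> x - \<phi> y)\<^sup>2 \<le> (\<Sum>v\<in>V. w x v * (\<phi> x - \<phi> v)\<^sup>2)"
    using assms finite_V by (intro member_le_sum[where f = "\<lambda>v. w x v * (\<phi> x - \<phi> v)\<^sup>2"]) auto
  also have "\<dots> \<le> (\<Sum>u\<in>V. \<Sum>v\<in>V. w u v * (\<phi> u - \<phi> v)\<^sup>2)"
    using assms finite_V
    by (intro member_le_sum[where f = "\<lambda>u. \<Sum>v\<in>V. w u v * (\<phi> u - \<phi> v)\<^sup>2"] sum_nonneg) auto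
  finally show ?thesis
    by (simp add: form_def power2_eq_square)
qed

end

section \<open>Deleting an edge of a cycle\<close>

lemma pcas_imp_rtrancl:
  assumes "pcas u p v" "set p \<subseteq> R"
  shows "(u, v) \<in> R\<^sup>*"
  using assms by (induction u p v rule: pcas.induct) (auto intro: converse_rtrancl_into_rtrancl)

lemma pcas_append: "pcas u (p @ q) v \<longleftrightarrow> (\<exists>x. pcas u p x \<and> pcas x q v)"
  by (induction p arbitrary: u) auto

lemma pcas_end_in_heads:
  assumes "pcas u p v" "p \<noteq> []"
  shows "v \<in> snd ` set p"
  using assms by (induction u p v rule: pcas.induct) (auto, metis image_eqI list.set_intros(1) pcas.simps(1) snd_conv)

text \<open>Comparing doubletons removes both orientations of the edge, so the relation stays
  symmetric when the graph is.\<close>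

definition arcs_without :: "'a pair_pre_digraph \<Rightarrow> 'a set \<Rightarrow> ('a \<times> 'a) set" where
  "arcs_without G e = {(x, y) \<in> parcs G. {x, y} \<noteq> e}"

text \<open>The rest of the cycle is a detour from \<open>b\<close> to \<open>a\<close>. Length at
  least 3 excludes an edge traversed back and forth, which also counts as a directed cycle.\<close>

lemma (in pair_graph) cycle_edge_redundant:
  assumes conn: "Digraph_Component.connected (with_proj G)"
    and cyc: "cycle p" "3 \<le> length p"
  obtains a b where "(a, b) \<in> parcs G"
    "\<And>x y. x \<in> pverts G \<Longrightarrow> y \<in> pverts G \<Longrightarrow> (x, y) \<in> (arcs_without G {a, b})\<^sup>*"
proof -
  obtain u where walk: "awalk u p u" and dist: "distinct (tl (awalk_verts u p))"
    using cyc unfolding cycle_def by auto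
  obtain a b q where p: "p = (a, b) # q"
    using cyc(2) by (cases p) auto
  have arcs: "(a, b) \<in> parcs G" "set q \<subseteq> parcs G" and cas: "pcas b q a"
    using walk unfolding p awalk_def by auto
  \<comment> \<open>The tail of the vertex list of a nonempty walk is its list of heads.\<close>
  have "distinct (map snd p)"
    using dist walk awalk_verts_conv'[of u p u] unfolding awalk_def p by auto
  then have heads: "distinct (map snd q)" "b \<notin> snd ` set q"
    unfolding p by auto
  \<comment> \<open>By distinct heads, \<open>z\<close> is the only arc of \<open>q\<close> entering
    \<open>a\<close>. Its source \<open>c\<close> is a head in the nonempty \<open>s\<close>, hence
    differs from \<open>b\<close>; so \<open>(b, a)\<close> is not in \<open>q\<close>.\<close>
  obtain s z where q: "q = s @ [z]"
    using cyc(2) unfolding p by (cases q rule: rev_cases) auto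
  have "s \<noteq> []"
    using cyc(2) unfolding p q by auto
  obtain c where z: "z = (c, a)" and s: "pcas b s c"
    using cas unfolding q pcas_append by (cases z) auto
  have "c \<noteq> b"
    using pcas_end_in_heads[OF s \<open>s \<noteq> []\<close>] heads(2) unfolding q by auto
  then have "(b, a) \<notin> set q"
    using heads(1) unfolding q z by (auto simp: rev_image_eqI)
  moreover have "(a, b) \<notin> set q"
    using heads(2) by (auto simp: rev_image_eqI)
  ultimately have "set q \<subseteq> arcs_without G {a, b}"
    using arcs(2) unfolding arcs_without_def by (auto simp: doubleton_eq_iff)
  then have ba: "(b, a) \<in> (arcs_without G {a, b})\<^sup>*"
    using pcas_imp_rtrancl[OF cas] by simp
  have "sym (arcs_without G {a, b})"
    unfolding arcs_without_def using arcs_symmetric by (auto simp: sym_def insert_commute)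
  then have ab: "(a, b) \<in> (arcs_without G {a, b})\<^sup>*"
    using ba by (meson sym_rtrancl symD)
  have "parcs G \<subseteq> (arcs_without G {a, b})\<^sup>*"
    using ab ba unfolding arcs_without_def by (auto simp: doubleton_eq_iff)
  then have sub: "(parcs G)\<^sup>* \<subseteq> (arcs_without G {a, b})\<^sup>*"
    by (rule rtrancl_subset_rtrancl)
  have "(x, y) \<in> (parcs G)\<^sup>*" if "x \<in> pverts G" "y \<in> pverts G" for x y
  proof -
    \<comment> \<open>Connectedness is defined through the symmetric closure, which adds nothing to
      reachability in a symmetric graph.\<close>
    have "x \<rightarrow>\<^sup>*\<^bsub>with_proj (mk_symmetric (with_proj G))\<^esub> y"
      using conn that unfolding connected_def strongly_connected_def by simp
    then have "x \<rightarrow>\<^sup>*\<^bsub>with_proj G\<^esub> y"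
      using reachable_mk_symmetric_eq sym_arcs by blast
    from reachable_rtranclI[OF this] show ?thesis by simp
  qed
  with sub that[OF arcs(1)] show thesis by blast
qed

section \<open>Oscillation along walks\<close>

lemma relpow_oscillation:
  fixes \<phi> :: "'a \<Rightarrow> real"
  assumes "(x, y) \<in> R ^^ k" and "\<And>x y. (x, y) \<in> R \<Longrightarrow> \<bar>\<phi> x - \<phi> y\<bar> \<le> d"
  shows "\<bar>\<phi> x - \<phi> y\<bar> \<le> real k * d"
  using assms(1)
proof (induction k arbitrary: y)
  case (Suc k)
  then obtain z where z: "(x, z) \<in> R ^^ k" "(z, y) \<in> R" by auto
  show ?case
    using Suc.IH[OF z(1)] assms(2)[OF z(2)] by (simp add: algebra_simps)
qed simp

text \<open>In a finite relation, reachability needs at most \<open>card R\<close> steps; the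
  increments telescope. The constant does not depend on the edge lengths.\<close>

lemma rtrancl_oscillation:
  fixes \<phi> :: "'a \<Rightarrow> real"
  assumes "finite R" "(x, y) \<in> R\<^sup>*" "0 \<le> d" and "\<And>x y. (x, y) \<in> R \<Longrightarrow> \<bar>\<phi> x - \<phi> y\<bar> \<le> d"
  shows "\<bar>\<phi> x - \<phi> y\<bar> \<le> real (card R) * d"
proof -
  obtain k where "k \<le> card R" "(x, y) \<in> R ^^ k"
    using assms(1,2) by (auto simp: rtrancl_finite_eq_relpow)
  then have "\<bar>\<phi> x - \<phi> y\<bar> \<le> real k * d"
    using relpow_oscillation assms(4) by metis
  also have "\<dots> \<le> real (card R) * d"
    using \<open>k \<le> card R\<close> assms(3) by (intro mult_right_mono) auto
  finally show ?thesis .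
qed

section \<open>Concentrating the length on one cycle edge\<close>

text \<open>Short edges alone connect all vertices, so the oscillation is at most
  \<open>n * d\<close>, with \<open>d\<close> bounding the jump over a short edge. No bound on the
  length of \<open>e\<close> enters. The arc \<open>(a, b)\<close> supplies two distinct
  vertices.\<close>

lemma (in pair_graph) lambda1_ge_of_short_edges:
  assumes ab: "(a, b) \<in> parcs G"
    and conn: "\<And>x y. x \<in> pverts G \<Longrightarrow> y \<in> pverts G \<Longrightarrow> (x, y) \<in> (arcs_without G e)\<^sup>*"
    and len: "edge_length G l" and total: "(\<Sum>u\<in>pverts G. m0 G l u) = 1"
    and short: "\<And>f. f \<in> edges G \<Longrightarrow> f \<noteq> e \<Longrightarrow> l f = \<epsilon>"
    and "0 < \<epsilon>" "0 < n" "card (arcs_without G e) \<le> n"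
  shows "1 / (2 * (real n)\<^sup>2 * \<epsilon>) \<le> lambda1 G l"
proof -
  define w where "w u v = (if (u, v) \<in> parcs G then m1 l {u, v} else 0)" for u v
  have edge: "{u, v} \<in> edges G" if "(u, v) \<in> parcs G" for u v
    using that unfolding edges_def by auto
  have pos: "0 < l {u, v}" if "(u, v) \<in> parcs G" for u v
    using len edge[OF that] unfolding edge_length_def by blast
  have V: "a \<in> pverts G" "b \<in> pverts G" "a \<noteq> b"
    using ab in_arcsD1 in_arcsD2 no_loops' by auto
  interpret weighted_network "pverts G" w "m0 G l"
  proof
    show "w u v = w v u" for u v
      unfolding w_def using arcs_symmetric by (auto simp: insert_commute)
    show "0 < m0 G l u" if "u \<in> pverts G" for u
    proof -
      \<comment> \<open>A path to any other vertex starts with an arc at \<open>u\<close>, so the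
        mass at \<open>u\<close> is a nonempty sum of positive lengths.\<close>
      obtain y where y: "y \<in> pverts G" "y \<noteq> u" using V by metis
      obtain v where "(u, v) \<in> arcs_without G e"
        using conn[OF \<open>u \<in> pverts G\<close> y(1)] y(2) by (auto elim: converse_rtranclE)
      then have v: "v \<in> nbrs G u"
        unfolding arcs_without_def nbrs_def using in_arcsD2 by auto
      show ?thesis
        unfolding m0_def
        by (rule sum_pos2[OF _ v]) (use v pos in \<open>auto simp: nbrs_def less_imp_le\<close>)
    qed
  qed (use total in auto)
  have w_nonneg: "0 \<le> w u v" for u v
    using pos unfolding w_def m1_def by (auto simp: less_imp_le)
  have lap: "laplacian \<phi> u = fujiwara_laplacian G l \<phi> u" for \<phi> u
  proof -
    have "(\<Sum>v\<in>pverts G. w u v * (\<phi> u - \<phi> v)) = (\<Sum>v\<in>nbrs G u. m1 l {u, v} * (\<phi> u - \<phi> v))"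
      by (rule sum.mono_neutral_cong_right) (auto simp: nbrs_def w_def)
    then show ?thesis
      unfolding laplacian_def fujiwara_laplacian_def by (simp add: sum_divide_distrib)
  qed
  have "lambda1 G l = (LEAST \<mu>. 0 < \<mu> \<and> eigenvalue \<mu>)"
    unfolding lambda1_def fujiwara_eigenvalue_def eigenvalue_def lap by simp
  moreover have "1 / (2 * (real n)\<^sup>2 * \<epsilon>) * sqnorm \<phi> \<le> form \<phi> \<phi>" if "mean \<phi> = 0" for \<phi>
  proof -
    \<comment> \<open>A short edge has conductance \<open>1 / \<epsilon>\<close>, so
      \<open>form_ge_term\<close> bounds the squared jump across it by
      \<open>2 * \<epsilon> * form \<phi> \<phi>\<close>.\<close>
    define d where "d = sqrt (2 * \<epsilon> * form \<phi> \<phi>)"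
    have "0 \<le> w a b * (\<phi> a - \<phi> b)\<^sup>2"
      using w_nonneg by simp
    also note form_ge_term[OF w_nonneg V(1,2)]
    finally have "0 \<le> form \<phi> \<phi>" by simp
    then have d: "0 \<le> d" "d\<^sup>2 = 2 * \<epsilon> * form \<phi> \<phi>"
      unfolding d_def using \<open>0 < \<epsilon>\<close> by simp_all
    have step: "\<bar>\<phi> x - \<phi> y\<bar> \<le> d" if xy: "(x, y) \<in> arcs_without G e" for x y
    proof -
      have "(x, y) \<in> parcs G" "l {x, y} = \<epsilon>"
        using xy short edge unfolding arcs_without_def by auto
      then have "w x y = 1 / \<epsilon>" "x \<in> pverts G" "y \<in> pverts G"
        unfolding w_def m1_def using in_arcsD1 in_arcsD2 by auto
      then have "1 / \<epsilon> * (\<phi> x - \<phi> y)\<^sup>2 \<le> 2 * form \<phi> \<phi>"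
        using form_ge_term[OF w_nonneg, of x y \<phi>] by simp
      then have "(\<phi> x - \<phi> y)\<^sup>2 \<le> 2 * \<epsilon> * form \<phi> \<phi>"
        using \<open>0 < \<epsilon>\<close> by (simp add: field_simps)
      then show ?thesis
        unfolding d_def by (intro real_le_rsqrt) simp
    qed
    have fin: "finite (arcs_without G e)"
      by (rule finite_subset[OF _ pair_finite_arcs]) (auto simp: arcs_without_def)
    have "\<bar>\<phi> x - \<phi> y\<bar> \<le> real n * d" if "x \<in> pverts G" "y \<in> pverts G" for x y
    proof -
      have "\<bar>\<phi> x - \<phi> y\<bar> \<le> real (card (arcs_without G e)) * d"
        using rtrancl_oscillation[OF fin conn[OF that] d(1) step] .
      also have "\<dots> \<le> real n * d"
        using assms d(1) by (intro mult_right_mono) auto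
      finally show ?thesis .
    qed
    from sqnorm_le_oscillation[OF that this]
    have "sqnorm \<phi> \<le> (real n)\<^sup>2 * (2 * \<epsilon> * form \<phi> \<phi>)"
      by (simp add: power_mult_distrib d(2))
    then show ?thesis
      using \<open>0 < \<epsilon>\<close> \<open>0 < n\<close> by (simp add: field_simps)
  qed
  ultimately show ?thesis
    using least_positive_eigenvalue_ge[OF V] \<open>0 < \<epsilon>\<close> \<open>0 < n\<close> by simp
qed

lemma (in pair_graph) exists_length_lambda1_gt:
  assumes conn: "Digraph_Component.connected (with_proj G)"
    and cyc: "cycle p" "3 \<le> length p" and "0 < M"
  shows "\<exists>l. edge_length G l \<and> 2 * (\<Sum>e\<in>edges G. l e) = 1 \<and> lambda1 G l > M"
proof -
  obtain a b where ab: "(a, b) \<in> parcs G"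
    and red: "\<And>x y. x \<in> pverts G \<Longrightarrow> y \<in> pverts G \<Longrightarrow> (x, y) \<in> (arcs_without G {a, b})\<^sup>*"
    using cycle_edge_redundant[OF conn cyc] by metis
  define e where "e = {a, b}"
  define n where "n = Suc (card (arcs_without G e))"
  define k where "k = real (card (edges G - {e}))"
  \<comment> \<open>The two summands of the denominator serve two demands:
    \<open>k * \<epsilon> < 1 / 2\<close> leaves positive length for \<open>e\<close>, and
    \<open>2 * (real n)\<^sup>2 * \<epsilon> * M < 1\<close> pushes the spectral bound above
    \<open>M\<close>.\<close>
  define \<epsilon> where "\<epsilon> = 1 / (4 * (k + 1) + 4 * (real n)\<^sup>2 * M)"
  \<comment> \<open>The lengths must sum to 1/2, since total mass counts each edge twice.\<close>
  define l where "l f = (if f = e then 1 / 2 - k * \<epsilon> else \<epsilon>)" for f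
  have "edges G = (\<lambda>(u, v). {u, v}) ` parcs G"
    unfolding edges_def by auto
  then have fin: "finite (edges G)" by simp
  have e: "e \<in> edges G"
    using ab unfolding e_def edges_def by auto
  have k: "0 \<le> k" and n: "0 < n" by (simp_all add: k_def n_def)
  have den: "0 < 4 * (k + 1) + 4 * (real n)\<^sup>2 * M"
    using k \<open>0 < M\<close> by (intro add_pos_nonneg) auto
  then have \<epsilon>: "0 < \<epsilon>" "\<epsilon> * (4 * (k + 1) + 4 * (real n)\<^sup>2 * M) = 1"
    unfolding \<epsilon>_def by auto
  have prods: "0 \<le> \<epsilon> * k" "0 \<le> \<epsilon> * ((real n)\<^sup>2 * M)"
    using \<epsilon>(1) k \<open>0 < M\<close> by simp_all
  have small: "k * \<epsilon> < 1 / 2" "2 * (real n)\<^sup>2 * \<epsilon> * M < 1"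
    using \<epsilon> prods by (simp_all add: algebra_simps)
  have len: "edge_length G l"
    unfolding edge_length_def l_def using \<epsilon>(1) small(1) by auto
  have "(\<Sum>f\<in>edges G. l f) = l e + (\<Sum>f\<in>edges G - {e}. l f)"
    using fin e by (rule sum.remove)
  also have "(\<Sum>f\<in>edges G - {e}. l f) = (\<Sum>f\<in>edges G - {e}. \<epsilon>)"
    by (rule sum.cong) (auto simp: l_def)
  finally have total: "2 * (\<Sum>f\<in>edges G. l f) = 1"
    by (simp add: l_def k_def)
  have "M < 1 / (2 * (real n)\<^sup>2 * \<epsilon>)"
    using small(2) \<epsilon>(1) n by (simp add: field_simps)
  also have "\<dots> \<le> lambda1 G l"
    using lambda1_ge_of_short_edges[OF ab red[folded e_def] len _ _ \<epsilon>(1) n] total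
    by (simp add: sum_m0 l_def n_def)
  finally show ?thesis
    using len total by blast
qed

theorem mainTheorem1:
  fixes G :: "'a pair_pre_digraph"
  assumes "pair_graph G"
    and "Digraph_Component.connected (with_proj G)"
    and "\<exists>p. pre_digraph.cycle (with_proj G) p \<and> 3 \<le> length p"
  shows "Lambda1 G = \<infinity> \<and>
    (\<forall>M > 0. \<exists>l. edge_length G l \<and> 2 * (\<Sum>e \<in> edges G. l e) = 1 \<and> lambda1 G l > M)"
proof -
  interpret pair_graph G by fact
  have large: "\<exists>l. edge_length G l \<and> 2 * (\<Sum>e \<in> edges G. l e) = 1 \<and> lambda1 G l > M"
    if "M > 0" for M
    using exists_length_lambda1_gt[OF assms(2) _ _ that] assms(3) by blast
  have "ereal M \<le> Lambda1 G" for M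
  proof -
    \<comment> \<open>\<open>large\<close> needs a positive threshold, whereas \<open>M\<close> is
      here an arbitrary real.\<close>
    obtain l where l: "edge_length G l" "2 * (\<Sum>e \<in> edges G. l e) = 1" "lambda1 G l > max M 1"
      using large[of "max M 1"] by (meson less_max_iff_disj zero_less_one)
    have "ereal M \<le> ereal (lambda1 G l)"
      using l(3) by simp
    also have "\<dots> \<le> Lambda1 G"
      unfolding Lambda1_def using l by (intro SUP_upper) (simp add: sum_m0)
    finally show ?thesis .
  qed
  then have "Lambda1 G = \<infinity>"
    by (intro ereal_top)
  with large show ?thesis by blast
qed

end
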